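(* For all $n\ge0$, $$H_n(B_{2k})=(-1)^n\frac{(4n+3)!}{(n+1)\cdot(2n+1)!^3}\cdot\mathcal{H}_{2n+1}\cdot H_n(B_{2k+2}),$$ where $B_j$ are the Bernoulli numbers and $\mathcal{H}_m:=\sum_{j=1}^m\frac1j$.
   Context: For a sequence $(a_k)_{k\ge 0}$ and $n\ge 0$, $H_n(a_k):=\det(a_{i+j})_{0\le i,j\le n}$ denotes the $(n+1)\times(n+1)$ Hankel determinant; in the claim the sequences are indexed by $k\ge0$. The Bernoulli numbers are defined by $\frac{t}{e^t-1}=\sum_{n\ge0}B_n\frac{t^n}{n!}$. The notation $(2n+1)!^3$ means $((2n+1)!)^3$. *)

theory Defs
  imports
    "HOL-Analysis.Harmonic_Numbers"
    "HOL-Computational_Algebra.Formal_Power_Series"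
    "Jordan_Normal_Form.Determinant"
begin

text \<open>Numerator and denominator both have subdegree \<open>1\<close>, so the division of formal power
  series is exact; see \<open>bernoulli_egf\<close> below.\<close>

definition bernoulli :: "nat \<Rightarrow> real" where
  "bernoulli n = fact n * fps_nth (fps_X / (fps_exp 1 - 1)) n"

lemma bernoulli_egf:
  "Abs_fps (\<lambda>n. bernoulli n / fact n) * (fps_exp 1 - 1) = fps_X"
proof -
  let ?E = "fps_exp 1 - 1 :: real fps"
  have nz: "fps_nth ?E 1 \<noteq> 0" by simp
  then have "?E \<noteq> 0" by (metis fps_zero_nth)
  moreover have "subdegree ?E = 1"
    by (rule subdegreeI) (use nz in auto)
  ultimately have "?E dvd fps_X"
    by (simp add: fps_dvd_iff)
  then have "fps_X / ?E * ?E = fps_X" by simp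
  moreover have "Abs_fps (\<lambda>n. bernoulli n / fact n) = fps_X / ?E"
    by (simp add: fps_eq_iff bernoulli_def)
  ultimately show ?thesis by simp
qed

text \<open>The index \<open>n\<close> is the largest row index: the matrix has size \<open>n + 1\<close>.\<close>

definition hankel_det :: "nat \<Rightarrow> (nat \<Rightarrow> 'a :: comm_ring_1) \<Rightarrow> 'a" where
  "hankel_det n a = Determinant.det (mat (n + 1) (n + 1) (\<lambda>(i, j). a (i + j)))"

end

theory Submission
  imports Defs
begin

text \<open>Let \<open>Q\<close> be the polynomial of degree \<open>n\<close> orthogonal with respect to the moments
  \<open>B\<^bsub>2k+2\<^esub>\<close>. Replacing the last column by the combination of columns given by the
  coefficients of \<open>Q\<close> leaves a single nonzero entry in that column in both Hankel matrices, with
  the same complementary minor up to sign. So the ratio of the determinants is, up to sign, the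
  ratio of the value of the moment functional of \<open>B\<^bsub>2k\<^esub>\<close> at \<open>Q\<close> to the norm of \<open>Q\<close>.

  Since \<open>B\<^bsub>2k+2\<^esub>\<close> are up to sign the moments of \<open>t\<^sup>2 / sinh\<^sup>2 (\<pi>t)\<close>, which is the weight of
  continuous Hahn polynomials with all parameters \<open>1\<close>, \<open>Q\<close> is explicit. Its orthogonality follows
  algebraically from the umbral rule \<open>L (f (x + 1)) = L f + f' 0\<close> for \<open>L (x\<^sup>k) = B\<^sub>k\<close>, which gives
  the values of \<open>L\<close> on products of rising factorials and so reduces everything to alternating
  binomial sums of rational functions; a double pole produces the harmonic number.\<close>

section \<open>Hankel determinants and orthogonal polynomials\<close>

text \<open>Compare entry \<open>n\<close> in \<open>adj_mat A * (A q) = det A * q\<close>: as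
  \<open>A q\<close> is supported on row \<open>r\<close>, a single cofactor survives.\<close>

lemma det_of_column_combination:
  fixes A :: "'a :: comm_ring_1 mat"
  assumes A: "A \<in> carrier_mat (Suc n) (Suc n)" and r: "r \<le> n"
    and zero: "\<And>i. i \<le> n \<Longrightarrow> i \<noteq> r \<Longrightarrow> (\<Sum>j\<le>n. A $$ (i, j) * q j) = 0"
  shows "q n * Determinant.det A = (\<Sum>j\<le>n. A $$ (r, j) * q j) * cofactor A r n"
proof -
  have adj: "(\<Sum>i\<le>n. cofactor A i n * A $$ (i, j)) = (if j = n then Determinant.det A else 0)"
    if "j \<le> n" for j
  proof -
    have "(adj_mat A * A) $$ (n, j) = (\<Sum>i\<le>n. cofactor A i n * A $$ (i, j))"
      unfolding times_mat_def scalar_prod_def adj_mat_def using that A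
      by (auto simp: atLeast0LessThan simp flip: lessThan_Suc_atMost intro!: sum.cong)
    moreover have "(adj_mat A * A) $$ (n, j) = (if j = n then Determinant.det A else 0)"
      using that by (simp add: adj_mat(3)[OF A])
    ultimately show ?thesis by simp
  qed
  have "(\<Sum>j\<le>n. A $$ (r, j) * q j) * cofactor A r n =
      (\<Sum>i\<in>{r}. cofactor A i n * (\<Sum>j\<le>n. A $$ (i, j) * q j))"
    by (simp add: mult.commute)
  also have "\<dots> = (\<Sum>i\<le>n. cofactor A i n * (\<Sum>j\<le>n. A $$ (i, j) * q j))"
    by (rule sum.mono_neutral_left) (use r zero in auto)
  also have "\<dots> = (\<Sum>i\<le>n. \<Sum>j\<le>n. q j * (cofactor A i n * A $$ (i, j)))"
    by (simp add: sum_distrib_left algebra_simps)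
  also have "\<dots> = (\<Sum>j\<le>n. q j * (\<Sum>i\<le>n. cofactor A i n * A $$ (i, j)))"
    by (subst sum.swap) (simp add: sum_distrib_left)
  also have "\<dots> = (\<Sum>j\<le>n. if j = n then q n * Determinant.det A else 0)"
    by (rule sum.cong) (simp_all add: adj)
  also have "\<dots> = q n * Determinant.det A"
    by simp
  finally show ?thesis ..
qed

text \<open>The coefficients \<open>q\<close> are those of the orthogonal polynomial of degree \<open>n\<close> for the
  moments \<open>a (k + 1)\<close>. Both determinants reduce to the same minor of size \<open>n\<close>.\<close>

lemma hankel_det_shift_ratio:
  fixes a q :: "nat \<Rightarrow> 'a :: idom"
  assumes "q n \<noteq> 0"
    and orth: "\<And>i. i < n \<Longrightarrow> (\<Sum>j\<le>n. q j * a (i + j + 1)) = 0"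
  shows "hankel_det n a * (\<Sum>j\<le>n. q j * a (n + j + 1)) =
    (- 1) ^ n * (\<Sum>j\<le>n. q j * a j) * hankel_det n (\<lambda>k. a (k + 1))"
proof -
  define A where "A = mat (Suc n) (Suc n) (\<lambda>(i, j). a (i + j))"
  define B where "B = mat (Suc n) (Suc n) (\<lambda>(i, j). a (i + j + 1))"
  define D where "D = Determinant.det (mat n n (\<lambda>(i, j). a (i + j + 1)))"
  have "mat_delete A 0 n = mat n n (\<lambda>(i, j). a (i + j + 1))"
    and "mat_delete B n n = mat n n (\<lambda>(i, j). a (i + j + 1))"
    by (auto simp: A_def B_def mat_delete_def intro!: eq_matI)
  then have cof: "cofactor A 0 n = (- 1) ^ n * D" "cofactor B n n = D"
    by (simp_all add: cofactor_def D_def flip: mult_2)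
  have "q n * Determinant.det A = (\<Sum>j\<le>n. A $$ (0, j) * q j) * cofactor A 0 n"
  proof (rule det_of_column_combination)
    \<comment> \<open>Row \<open>i > 0\<close> of \<open>A\<close> is row \<open>i - 1\<close> of
      \<open>B\<close>, so orthogonality clears every row of \<open>A\<close> except row 0.\<close>
    fix i assume i: "i \<le> n" "i \<noteq> 0"
    then obtain i' where i': "i = Suc i'" by (cases i) auto
    have "(\<Sum>j\<le>n. A $$ (i, j) * q j) = (\<Sum>j\<le>n. q j * a (i' + j + 1))"
      by (rule sum.cong) (use i i' in \<open>auto simp: A_def mult.commute\<close>)
    then show "(\<Sum>j\<le>n. A $$ (i, j) * q j) = 0"
      using orth[of i'] i i' by simp
  qed (auto simp: A_def)
  also have "(\<Sum>j\<le>n. A $$ (0, j) * q j) = (\<Sum>j\<le>n. q j * a j)"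
    by (rule sum.cong) (auto simp: A_def mult.commute)
  finally have 1: "q n * Determinant.det A = (\<Sum>j\<le>n. q j * a j) * ((- 1) ^ n * D)"
    by (simp add: cof)
  have "q n * Determinant.det B = (\<Sum>j\<le>n. B $$ (n, j) * q j) * cofactor B n n"
  proof (rule det_of_column_combination)
    fix i assume i: "i \<le> n" "i \<noteq> n"
    have "(\<Sum>j\<le>n. B $$ (i, j) * q j) = (\<Sum>j\<le>n. q j * a (i + j + 1))"
      by (rule sum.cong) (use i in \<open>auto simp: B_def mult.commute\<close>)
    then show "(\<Sum>j\<le>n. B $$ (i, j) * q j) = 0"
      using orth[of i] i by simp
  qed (auto simp: B_def)
  also have "(\<Sum>j\<le>n. B $$ (n, j) * q j) = (\<Sum>j\<le>n. q j * a (n + j + 1))"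
    by (rule sum.cong) (auto simp: B_def mult.commute)
  finally have 2: "q n * Determinant.det B = (\<Sum>j\<le>n. q j * a (n + j + 1)) * D"
    by (simp add: cof)
  have "q n * (Determinant.det A * (\<Sum>j\<le>n. q j * a (n + j + 1))) =
      (q n * Determinant.det A) * (\<Sum>j\<le>n. q j * a (n + j + 1))"
    by (simp add: mult.assoc)
  also have "\<dots> = (- 1) ^ n * (\<Sum>j\<le>n. q j * a j) * (q n * Determinant.det B)"
    unfolding 1 2 by (simp add: algebra_simps)
  also have "\<dots> = q n * ((- 1) ^ n * (\<Sum>j\<le>n. q j * a j) * Determinant.det B)"
    by (simp add: algebra_simps)
  finally show ?thesis
    using \<open>q n \<noteq> 0\<close> by (simp add: A_def B_def hankel_det_def)
qed

section \<open>The umbral functional of the Bernoulli numbers\<close>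

text \<open>Coefficient \<open>n\<close> of \<open>bernoulli_egf\<close>; the term
  \<open>i = n\<close> is absent because \<open>fps_exp 1 - 1\<close> has no constant term.\<close>

lemma bernoulli_recurrence:
  "(\<Sum>i<n. real (n choose i) * bernoulli i) = (if n = 1 then 1 else 0)"
proof -
  let ?b = "Abs_fps (\<lambda>n. bernoulli n / fact n)"
  have "fps_nth (?b * (fps_exp 1 - 1)) n = (\<Sum>i\<le>n. bernoulli i / fact i * (1 / fact (n - i) - (if n - i = 0 then 1 else 0)))"
    by (simp add: fps_mult_nth atLeast0AtMost)
  also have "\<dots> = (\<Sum>i<n. bernoulli i / fact i * (1 / fact (n - i)))"
    by (rule sum.mono_neutral_cong_right) auto
  also have "\<dots> = (\<Sum>i<n. real (n choose i) * bernoulli i) / fact n"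
    unfolding sum_divide_distrib by (rule sum.cong) (auto simp: binomial_fact field_simps)
  finally have "(\<Sum>i<n. real (n choose i) * bernoulli i) = fact n * fps_nth (fps_X :: real fps) n"
    unfolding bernoulli_egf by simp
  then show ?thesis by (cases "n = 1") auto
qed

text \<open>With b(t) = t / (e^t - 1), substituting -t gives b(-t) = b(t) + t, so t is the only odd
  power that can occur in b.\<close>

lemma bernoulli_odd_eq_0:
  assumes "odd n" "n \<noteq> 1"
  shows "bernoulli n = 0"
proof -
  let ?b = "Abs_fps (\<lambda>n. bernoulli n / fact n)"
  let ?m = "fps_const (- 1) * fps_X :: real fps"
  have "fps_exp 1 oo ?m = fps_exp (- 1)"
    by (simp only: fps_compose_linear) (simp add: fps_eq_iff)
  then have "(?b * (fps_exp 1 - 1)) oo ?m = (?b oo ?m) * (fps_exp (- 1) - 1)"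
    by (simp add: fps_compose_mult_distrib fps_compose_sub_distrib)
  then have "(?b oo ?m) * (fps_exp (- 1) - 1) * fps_exp 1 = - fps_X * fps_exp 1"
    unfolding bernoulli_egf by (simp flip: fps_const_neg)
  moreover have "(fps_exp (- 1) - 1) * fps_exp 1 = (1 - fps_exp 1 :: real fps)"
    by (simp add: left_diff_distrib flip: fps_exp_add_mult)
  ultimately have "(?b oo ?m) * (1 - fps_exp 1) = - fps_X * fps_exp 1"
    by (simp only: mult.assoc)
  then have "(?b oo ?m) * (fps_exp 1 - 1) = fps_X * fps_exp 1"
    by (simp add: algebra_simps)
  also have "\<dots> = (?b + fps_X) * (fps_exp 1 - 1)"
    unfolding distrib_right bernoulli_egf by (simp add: algebra_simps)
  finally have "?b oo ?m = ?b + fps_X"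
  proof (subst (asm) mult_cancel_right, elim disjE)
    assume "fps_exp 1 - 1 = (0 :: real fps)"
    then have "fps_nth (fps_exp 1 - 1 :: real fps) 1 = 0" by (metis fps_zero_nth)
    then show ?thesis by simp
  qed
  then have "fps_nth (?b oo ?m) n = fps_nth (?b + fps_X) n" by simp
  then show ?thesis
    using assms by (simp add: fps_compose_linear)
qed

definition bernoulli_umbra :: "real poly \<Rightarrow> real" where
  "bernoulli_umbra p = (\<Sum>i\<le>degree p. coeff p i * bernoulli i)"

lemma bernoulli_umbra_altdef:
  assumes "degree p \<le> n"
  shows "bernoulli_umbra p = (\<Sum>i\<le>n. coeff p i * bernoulli i)"
  unfolding bernoulli_umbra_def
  by (rule sum.mono_neutral_left) (use assms in \<open>auto simp: coeff_eq_0\<close>)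

lemma bernoulli_umbra_add: "bernoulli_umbra (p + q) = bernoulli_umbra p + bernoulli_umbra q"
proof -
  let ?n = "max (degree p) (degree q)"
  have "degree (p + q) \<le> ?n" by (rule degree_add_le_max)
  then show ?thesis
    by (simp add: bernoulli_umbra_altdef[of _ ?n] sum.distrib distrib_right)
qed

lemma bernoulli_umbra_smult: "bernoulli_umbra (smult c p) = c * bernoulli_umbra p"
  by (simp add: bernoulli_umbra_altdef[of _ "degree p"] degree_smult_le sum_distrib_left mult.assoc)

lemma bernoulli_umbra_0 [simp]: "bernoulli_umbra 0 = 0"
  by (simp add: bernoulli_umbra_def)

lemma bernoulli_umbra_uminus: "bernoulli_umbra (- p) = - bernoulli_umbra p"
  using bernoulli_umbra_smult[of "- 1" p] by simp

lemma bernoulli_umbra_diff: "bernoulli_umbra (p - q) = bernoulli_umbra p - bernoulli_umbra q"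
  using bernoulli_umbra_add[of p "- q"] by (simp add: bernoulli_umbra_uminus)

lemma bernoulli_umbra_sum: "bernoulli_umbra (sum f A) = (\<Sum>x\<in>A. bernoulli_umbra (f x))"
  by (induction A rule: infinite_finite_induct) (simp_all add: bernoulli_umbra_add)

text \<open>Subtracting a multiple of \<open>e d\<close> removes the top coefficient, so one
  polynomial of each degree below \<open>m\<close> suffices. Stating the bound on \<open>q\<close>
  by zero coefficients makes \<open>m = 0\<close> mean \<open>q = 0\<close>.\<close>

lemma linear_functional_eq_0:
  fixes \<phi> :: "'a :: field poly \<Rightarrow> 'a" and e :: "nat \<Rightarrow> 'a poly"
  assumes add: "\<And>p q. \<phi> (p + q) = \<phi> p + \<phi> q"
    and smult: "\<And>c p. \<phi> (smult c p) = c * \<phi> p"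
    and degree: "\<And>j. j < m \<Longrightarrow> degree (e j) = j" and nonzero: "\<And>j. j < m \<Longrightarrow> e j \<noteq> 0"
    and zero: "\<And>j. j < m \<Longrightarrow> \<phi> (e j) = 0"
    and q: "\<And>i. i \<ge> m \<Longrightarrow> coeff q i = 0"
  shows "\<phi> q = 0"
proof -
  have "\<phi> q = 0" if "d \<le> m" "\<And>i. i \<ge> d \<Longrightarrow> coeff q i = 0" for d q
    using that
  proof (induction d arbitrary: q)
    case 0
    then have "q = 0" by (simp add: poly_eq_iff)
    then show ?case using smult[of 0 0] by simp
  next
    case (Suc d)
    define c where "c = coeff q d / lead_coeff (e d)"
    let ?r = "q + smult (- c) (e d)"
    have e: "degree (e d) = d" "e d \<noteq> 0" "\<phi> (e d) = 0"
      using Suc.prems degree nonzero zero by auto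
    have "coeff ?r i = 0" if "i \<ge> d" for i
    proof (cases "i = d")
      case True
      moreover have "coeff (e d) d \<noteq> 0" using e by (metis leading_coeff_0_iff)
      ultimately show ?thesis using e by (simp add: c_def)
    next
      case False
      then show ?thesis using e that Suc.prems(2)[of i] by (simp add: coeff_eq_0)
    qed
    then have "\<phi> ?r = 0"
      using Suc by simp
    then show ?case
      by (simp only: add smult e(3)) simp
  qed
  from this[of m] q show ?thesis by blast
qed

text \<open>Both sides are linear in \<open>p\<close>, and on monomials the rule is
  \<open>bernoulli_recurrence\<close>.\<close>

lemma bernoulli_umbra_shift:
  "bernoulli_umbra (p \<circ>\<^sub>p [:1, 1:]) = bernoulli_umbra p + coeff p 1"
proof -
  let ?\<phi> = "\<lambda>p. bernoulli_umbra (p \<circ>\<^sub>p [:1, 1:]) - (bernoulli_umbra p + coeff p 1)"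
  have "?\<phi> p = 0"
  proof (rule linear_functional_eq_0[where \<phi> = ?\<phi> and e = "\<lambda>n. monom 1 n" and m = "Suc (degree p)"])
    fix j :: nat
    have "monom 1 j \<circ>\<^sub>p [:1, 1 :: real:] = [:1, 1:] ^ j"
      by (induction j) (simp_all add: monom_Suc pcompose_pCons pcompose_1)
    moreover have "bernoulli_umbra ([:1, 1:] ^ j) = (\<Sum>i\<le>j. real (j choose i) * bernoulli i)"
      by (subst bernoulli_umbra_altdef[of _ j])
         (simp_all add: degree_power_eq coeff_linear_poly_power)
    moreover have "\<dots> = (\<Sum>i<j. real (j choose i) * bernoulli i) + bernoulli j"
      by (simp flip: lessThan_Suc_atMost)
    moreover have "bernoulli_umbra (monom 1 j) = bernoulli j"
      by (subst bernoulli_umbra_altdef[of _ j]) (simp_all add: degree_monom_eq if_distrib[of "\<lambda>x. x * _"] cong: if_cong)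
    ultimately show "?\<phi> (monom 1 j) = 0"
      by (simp add: bernoulli_recurrence)
  qed (auto simp: pcompose_add pcompose_smult bernoulli_umbra_add bernoulli_umbra_smult
         degree_monom_eq coeff_eq_0 algebra_simps)
  then show ?thesis by simp
qed

section \<open>Values on rising factorials\<close>

lemma pcompose_pochhammer:
  "pochhammer p n \<circ>\<^sub>p q = pochhammer (p \<circ>\<^sub>p q) n" for p q :: "'a :: comm_ring_1 poly"
  by (induction n) (simp_all add: pochhammer_Suc pcompose_mult pcompose_add pcompose_1 of_nat_poly)

lemma poly_pochhammer: "poly (pochhammer p n) x = pochhammer (poly p x) n"
  for p :: "'a :: comm_ring_1 poly"
  by (induction n) (simp_all add: pochhammer_Suc of_nat_poly)

lemma degree_lead_coeff_pochhammer_linear: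
  fixes a b :: "'a :: idom"
  assumes "b \<noteq> 0"
  shows "degree (pochhammer [:a, b:] n) = n \<and> lead_coeff (pochhammer [:a, b:] n) = b ^ n"
proof (induction n)
  case (Suc n)
  then have "pochhammer [:a, b:] n \<noteq> 0" using assms by auto
  moreover have "[:a, b:] + of_nat n = [:a + of_nat n, b:]" by (simp add: of_nat_poly)
  moreover have "degree [:a + of_nat n, b:] = 1" "[:a + of_nat n, b:] \<noteq> 0" "lead_coeff [:a + of_nat n, b:] = b"
    using assms by simp_all
  ultimately show ?case
    using Suc unfolding pochhammer_Suc lead_coeff_mult by (metis Suc_eq_plus1 degree_mult_eq power_Suc2)
qed simp

text \<open>For f = x(x+1)...(x+k), f(x+1) - f(x) = (k+1)(x+1)...(x+k), so the shift rule gives the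
  value from the linear coefficient k! of f.\<close>

lemma bernoulli_umbra_pochhammer_1:
  "bernoulli_umbra (pochhammer [:1, 1:] k) = fact k / (real k + 1)"
proof -
  let ?f = "pochhammer [:0, 1:] (Suc k) :: real poly"
  have f: "?f = pCons 0 (pochhammer [:1, 1:] k)"
    by (simp add: pochhammer_rec one_pCons)
  have "?f \<circ>\<^sub>p [:1, 1:] = pochhammer [:1, 1:] (Suc k)"
    by (simp add: pcompose_pochhammer pcompose_pCons)
  also have "\<dots> = ?f + smult (real k + 1) (pochhammer [:1, 1:] k)"
    by (simp only: f pochhammer_Suc[of "[:1, 1:]"]) (simp add: of_nat_poly algebra_simps smult_add_left)
  finally have "coeff ?f 1 = (real k + 1) * bernoulli_umbra (pochhammer [:1, 1:] k)"
    using bernoulli_umbra_shift[of ?f] by (simp add: bernoulli_umbra_add bernoulli_umbra_smult)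
  moreover have "coeff ?f 1 = fact k"
    by (simp add: f poly_pochhammer pochhammer_fact flip: poly_0_coeff_0)
  ultimately show ?thesis by (simp add: field_simps)
qed

text \<open>Write the initial factor x as (x+k+1) - (k+1).\<close>

lemma bernoulli_umbra_pochhammer_0:
  "bernoulli_umbra (pochhammer [:0, 1:] (Suc k)) = - fact k / (real k + 2)"
proof -
  have "pochhammer [:0, 1:] (Suc k) = pochhammer [:1, 1:] (Suc k) - smult (real k + 1) (pochhammer [:1, 1:] k)"
    by (simp only: pochhammer_rec[of "[:0, 1:]"] pochhammer_Suc[of "[:1, 1:]"])
       (simp add: one_pCons of_nat_poly algebra_simps smult_add_left)
  then show ?thesis
    by (simp only: bernoulli_umbra_diff bernoulli_umbra_smult bernoulli_umbra_pochhammer_1)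
       (simp add: divide_simps, simp add: algebra_simps)
qed

text \<open>The next factors x + a and -x + b add up to a constant. The resulting recurrence trades
  a factor of one kind for one of the other, down to a single rising factorial.\<close>

lemma bernoulli_umbra_pochhammer_mult:
  "bernoulli_umbra (pochhammer [:0, 1:] (Suc a) * pochhammer [:0, - 1:] (Suc b)) =
     - fact (Suc a) * fact (Suc b) / ((real a + real b + 2) * (real a + real b + 3))"
proof -
  let ?A = "\<lambda>a b. bernoulli_umbra (pochhammer [:0, 1:] a * pochhammer [:0, - 1:] b)"
  have rec: "?A a (Suc b) = (real a + real b) * ?A a b - ?A (Suc a) b" for a b
  proof -
    have "pochhammer [:0, 1:] (Suc a) * pochhammer [:0, - 1:] b +
        pochhammer [:0, 1:] a * pochhammer [:0, - 1:] (Suc b) =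
        smult (real a + real b) (pochhammer [:0, 1:] a * pochhammer [:0, - 1:] b)"
      by (simp add: pochhammer_Suc of_nat_poly algebra_simps smult_add_left)
    from arg_cong[OF this, of bernoulli_umbra] show ?thesis
      by (simp add: bernoulli_umbra_add bernoulli_umbra_smult)
  qed
  show ?thesis
  proof (induction b arbitrary: a)
    case 0
    have "?A (Suc a) (Suc 0) = (real a + 1) * (- fact a / (real a + 2)) + fact (Suc a) / (real a + 3)"
      using bernoulli_umbra_pochhammer_0[of a] bernoulli_umbra_pochhammer_0[of "Suc a"]
      by (subst rec) (simp add: add_ac)
    also have "\<dots> = - fact (Suc a) / ((real a + 2) * (real a + 3))"
      by (simp add: field_simps)
    finally show ?case by simp
  next
    case (Suc b)
    have "?A (Suc a) (Suc (Suc b)) = (real a + real b + 2) * ?A (Suc a) (Suc b) - ?A (Suc (Suc a)) (Suc b)"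
      by (subst rec) (simp add: add_ac)
    also have "\<dots> = - fact (Suc a) * fact (Suc b) / (real a + real b + 3) +
        (real a + 2) * fact (Suc a) * fact (Suc b) / ((real a + real b + 3) * (real a + real b + 4))"
      unfolding Suc by (simp add: divide_simps) (simp add: algebra_simps)
    also have "\<dots> = - fact (Suc a) * (fact (Suc b) * (real b + 2)) / ((real a + real b + 3) * (real a + real b + 4))"
      by (simp add: divide_simps del: fact_Suc) (simp add: algebra_simps del: fact_Suc)
    finally show ?case by (simp add: algebra_simps)
  qed
qed

text \<open>Since x^2 = -x(-x), the weight x^2 supplies the initial factor missing from each rising
  factorial.\<close>

lemma bernoulli_umbra_square_pochhammer_mult:
  "bernoulli_umbra (monom 1 2 * pochhammer [:1, 1:] k * pochhammer [:1, - 1:] j) =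
     fact (k + 1) * fact (j + 1) / ((real k + real j + 2) * (real k + real j + 3))"
proof -
  have "monom 1 2 * pochhammer [:1, 1:] k * pochhammer [:1, - 1 :: real:] j =
      - (pochhammer [:0, 1:] (Suc k) * pochhammer [:0, - 1:] (Suc j))"
    by (simp add: pochhammer_rec one_pCons monom_Suc numeral_2_eq_2)
  then show ?thesis
    by (simp add: bernoulli_umbra_uminus bernoulli_umbra_pochhammer_mult del: fact_Suc)
qed

section \<open>Alternating binomial sums\<close>

text \<open>Pascal's rule: a finite difference of order \<open>Suc m\<close> is one of order
  \<open>m\<close> applied to first differences.\<close>

lemma alternating_binomial_sum_Suc:
  fixes f :: "nat \<Rightarrow> 'a :: comm_ring_1"
  shows "(\<Sum>k\<le>Suc m. (- 1) ^ k * of_nat (Suc m choose k) * f k) =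
    (\<Sum>k\<le>m. (- 1) ^ k * of_nat (m choose k) * (f k - f (Suc k)))"
proof -
  have "(\<Sum>k\<le>Suc m. (- 1) ^ k * of_nat (Suc m choose k) * f k) =
      f 0 + (\<Sum>k\<le>m. (- 1) ^ Suc k * of_nat (m choose Suc k) * f (Suc k))
        - (\<Sum>k\<le>m. (- 1) ^ k * of_nat (m choose k) * f (Suc k))"
    by (subst sum.atMost_Suc_shift) (simp add: algebra_simps sum.distrib sum_negf sum_subtractf)
  also have "f 0 + (\<Sum>k\<le>m. (- 1) ^ Suc k * of_nat (m choose Suc k) * f (Suc k)) =
      (\<Sum>k\<le>Suc m. (- 1) ^ k * of_nat (m choose k) * f k)"
    by (subst sum.atMost_Suc_shift) simp
  also have "\<dots> = (\<Sum>k\<le>m. (- 1) ^ k * of_nat (m choose k) * f k)"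
    by (simp add: binomial_eq_0)
  finally show ?thesis
    by (simp add: sum_subtractf right_diff_distrib)
qed

text \<open>Each difference lowers the degree, since \<open>q\<close> and its shift share the
  leading coefficient.\<close>

lemma alternating_binomial_sum_poly:
  fixes q :: "real poly"
  assumes "\<And>i. i \<ge> m \<Longrightarrow> coeff q i = 0"
  shows "(\<Sum>k\<le>m. (- 1) ^ k * real (m choose k) * poly q (real k)) = 0"
  using assms
proof (induction m arbitrary: q)
  case 0
  then have "q = 0" by (simp add: poly_eq_iff)
  then show ?case by simp
next
  case (Suc m)
  let ?r = "q - q \<circ>\<^sub>p [:1, 1:]"
  have deg: "degree q \<le> m"
    by (rule degree_le) (use Suc.prems in auto)
  have degc: "degree (q \<circ>\<^sub>p [:1, 1:]) = degree q"
    by (simp add: degree_pcompose)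
  have "coeff ?r i = 0" if "i \<ge> m" for i
  proof (cases "i = degree q")
    case True
    have "lead_coeff (q \<circ>\<^sub>p [:1, 1:]) = lead_coeff q"
      by (subst lead_coeff_comp) simp_all
    then show ?thesis using True degc by simp
  next
    case False
    then show ?thesis using that deg degc by (simp add: coeff_eq_0)
  qed
  then have "(\<Sum>k\<le>m. (- 1) ^ k * real (m choose k) * poly ?r (real k)) = 0"
    by (rule Suc.IH)
  then show ?case
    unfolding alternating_binomial_sum_Suc by (simp add: poly_pcompose add.commute)
qed

text \<open>The partial fraction expansion of m! / (c(c+1)...(c+m)). Differencing shifts
  \<open>c\<close> to \<open>c + 1\<close>, hence the induction over all \<open>c\<close>.\<close>

lemma alternating_binomial_sum_inverse:
  fixes c :: real
  assumes "c > 0"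
  shows "(\<Sum>k\<le>m. (- 1) ^ k * real (m choose k) * (1 / (real k + c))) = fact m / pochhammer c (Suc m)"
  using assms
proof (induction m arbitrary: c)
  case (Suc m)
  define P where "P = pochhammer (c + 1) m"
  have [simp]: "P > 0" using Suc.prems by (simp add: P_def pochhammer_pos)
  have p: "pochhammer c (Suc m) = c * P" "pochhammer (c + 1) (Suc m) = P * (c + 1 + real m)"
    "pochhammer c (Suc (Suc m)) = c * P * (c + 1 + real m)"
    by (simp_all add: P_def pochhammer_rec[of c] pochhammer_Suc[of "c + 1"])
  have "(\<Sum>k\<le>Suc m. (- 1) ^ k * real (Suc m choose k) * (1 / (real k + c))) =
      fact m / pochhammer c (Suc m) - fact m / pochhammer (c + 1) (Suc m)"
    unfolding alternating_binomial_sum_Suc right_diff_distrib sum_subtractf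
    using Suc.IH[of c] Suc.IH[of "c + 1"] Suc.prems by (simp add: add_ac)
  also have "\<dots> = fact (Suc m) / pochhammer c (Suc (Suc m))"
    unfolding p using Suc.prems by (simp add: divide_simps) (simp add: algebra_simps)
  finally show ?case .
qed simp

text \<open>Formally, minus the derivative in \<open>c\<close> of the preceding identity; the proof
  repeats its induction.\<close>

lemma alternating_binomial_sum_inverse_square:
  fixes c :: real
  assumes "c > 0"
  shows "(\<Sum>k\<le>m. (- 1) ^ k * real (m choose k) * (1 / (real k + c)\<^sup>2)) =
    fact m / pochhammer c (Suc m) * (\<Sum>i\<le>m. 1 / (c + real i))"
  using assms
proof (induction m arbitrary: c)
  case 0
  then show ?case by (simp add: power2_eq_square)
next
  case (Suc m)
  define P where "P = pochhammer (c + 1) m"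
  define S where "S = (\<Sum>i\<le>m. 1 / (c + real i))"
  have [simp]: "P > 0" using Suc.prems by (simp add: P_def pochhammer_pos)
  have p: "pochhammer c (Suc m) = c * P" "pochhammer (c + 1) (Suc m) = P * (c + 1 + real m)"
    "pochhammer c (Suc (Suc m)) = c * P * (c + 1 + real m)"
    by (simp_all add: P_def pochhammer_rec[of c] pochhammer_Suc[of "c + 1"])
  have S1: "(\<Sum>i\<le>Suc m. 1 / (c + real i)) = S + 1 / (c + 1 + real m)"
    by (simp add: S_def add_ac)
  moreover have "(\<Sum>i\<le>Suc m. 1 / (c + real i)) = 1 / c + (\<Sum>i\<le>m. 1 / (c + 1 + real i))"
    by (subst sum.atMost_Suc_shift) (simp add: add_ac)
  ultimately have S2: "(\<Sum>i\<le>m. 1 / (c + 1 + real i)) = S - 1 / c + 1 / (c + 1 + real m)"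
    by simp
  have "(\<Sum>k\<le>Suc m. (- 1) ^ k * real (Suc m choose k) * (1 / (real k + c)\<^sup>2)) =
      fact m / pochhammer c (Suc m) * S
        - fact m / pochhammer (c + 1) (Suc m) * (\<Sum>i\<le>m. 1 / (c + 1 + real i))"
    unfolding alternating_binomial_sum_Suc right_diff_distrib sum_subtractf
    using Suc.IH[of c] Suc.IH[of "c + 1"] Suc.prems by (simp add: add_ac S_def)
  also have "\<dots> = fact (Suc m) / pochhammer c (Suc (Suc m)) * (S + 1 / (c + 1 + real m))"
    unfolding p S2 using Suc.prems by (simp add: divide_simps) (simp add: algebra_simps)
  finally show ?case unfolding S1 .
qed

text \<open>Division by x + c leaves the remainder g(-c) and a quotient of degree below
  \<open>m\<close>, whose alternating sum vanishes.\<close>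

lemma alternating_binomial_sum_poly_divide:
  fixes g :: "real poly"
  assumes "degree g \<le> m" "c > 0"
  shows "(\<Sum>k\<le>m. (- 1) ^ k * real (m choose k) * (poly g (real k) / (real k + c))) =
    poly g (- c) * (fact m / pochhammer c (Suc m))"
proof -
  define s where "s = synthetic_div g (- c)"
  have g: "g = [:c, 1:] * s + [:poly g (- c):]"
    using synthetic_div_correct'[of "- c" g] by (simp add: s_def)
  have "coeff s i = 0" if "i \<ge> m" for i
  proof (cases "degree g = 0")
    \<comment> \<open>A constant \<open>g\<close> has quotient 0, which a degree bound alone would
      not give for \<open>m = 0\<close>.\<close>
    case True
    then show ?thesis by (simp add: s_def synthetic_div_eq_0_iff[THEN iffD2])
  next
    case False
    then show ?thesis
      using that assms by (intro coeff_eq_0) (simp add: s_def degree_synthetic_div)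
  qed
  then have s: "(\<Sum>k\<le>m. (- 1) ^ k * real (m choose k) * poly s (real k)) = 0"
    by (rule alternating_binomial_sum_poly)
  have "poly g (real k) / (real k + c) = poly s (real k) + poly g (- c) * (1 / (real k + c))" for k
    using \<open>c > 0\<close> by (subst g) (simp add: field_simps add_pos_nonneg)
  then have "(\<Sum>k\<le>m. (- 1) ^ k * real (m choose k) * (poly g (real k) / (real k + c))) =
      (\<Sum>k\<le>m. (- 1) ^ k * real (m choose k) * poly s (real k)) +
      poly g (- c) * (\<Sum>k\<le>m. (- 1) ^ k * real (m choose k) * (1 / (real k + c)))"
    by (simp add: distrib_left sum.distrib sum_distrib_left algebra_simps)
  then show ?thesis
    unfolding s alternating_binomial_sum_inverse[OF \<open>c > 0\<close>] by simp
qed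

section \<open>The orthogonal polynomials of the moments \<open>bernoulli (k + 2)\<close>\<close>

text \<open>Up to normalisation, these are the continuous Hahn polynomials
  ${}_3F_2(-m, m + 3, 1 + x; 2, 2; 1)$ on the imaginary axis.\<close>

definition hahn_poly :: "nat \<Rightarrow> real poly" where
  "hahn_poly m = (\<Sum>k\<le>m. smult ((- 1) ^ k * real (m choose k) *
     (pochhammer (real k + 2) (Suc m) / fact (Suc k))) (pochhammer [:1, 1:] k))"

lemma degree_hahn_poly_le: "degree (hahn_poly m) \<le> m"
  unfolding hahn_poly_def
  by (rule degree_sum_le)
     (auto intro!: order.trans[OF degree_smult_le] simp: degree_lead_coeff_pochhammer_linear)

lemma coeff_hahn_poly_degree_neq_0: "coeff (hahn_poly m) m \<noteq> 0"
proof -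
  have "coeff (pochhammer [:1, 1 :: real:] k) m = (if k = m then 1 else 0)" if "k \<le> m" for k
    using that degree_lead_coeff_pochhammer_linear[of "1 :: real" 1 k] by (auto simp: coeff_eq_0)
  then have "coeff (hahn_poly m) m =
      (\<Sum>k\<le>m. if k = m then (- 1) ^ m * (pochhammer (real m + 2) (Suc m) / fact (Suc m)) else 0)"
    unfolding hahn_poly_def coeff_sum by (intro sum.cong) auto
  moreover have "pochhammer (real m + 2) (Suc m) > 0"
    by (rule pochhammer_pos) simp
  ultimately show ?thesis by (simp del: pochhammer_Suc fact_Suc)
qed

text \<open>The denominators \<open>fact (Suc k)\<close> in \<open>hahn_poly\<close> cancel against
  the product formula, leaving a rational function of \<open>k\<close>.\<close>

lemma bernoulli_umbra_hahn_poly_mult_pochhammer: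
  "bernoulli_umbra (monom 1 2 * hahn_poly m * pochhammer [:1, - 1:] j) =
    fact (Suc j) * (\<Sum>k\<le>m. (- 1) ^ k * real (m choose k) *
      (pochhammer (real k + 2) (Suc m) / ((real k + real j + 2) * (real k + real j + 3))))"
proof -
  have "monom 1 2 * hahn_poly m * pochhammer [:1, - 1:] j =
      (\<Sum>k\<le>m. smult ((- 1) ^ k * real (m choose k) * (pochhammer (real k + 2) (Suc m) / fact (Suc k)))
        (monom 1 2 * pochhammer [:1, 1:] k * pochhammer [:1, - 1:] j))"
    unfolding hahn_poly_def sum_distrib_left sum_distrib_right by simp
  then show ?thesis
    by (simp add: bernoulli_umbra_sum bernoulli_umbra_smult bernoulli_umbra_square_pochhammer_mult
        sum_distrib_left del: fact_Suc) (simp add: mult_ac)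
qed

text \<open>For \<open>j < m\<close> both denominators occur among the factors k+2, ..., k+m+2 of
  the rising factorial, so the summand is a polynomial in \<open>k\<close> of degree m-1.\<close>

lemma bernoulli_umbra_hahn_poly_orthogonal:
  assumes "j < m"
  shows "bernoulli_umbra (monom 1 2 * hahn_poly m * pochhammer [:1, - 1:] j) = 0"
proof -
  define q :: "real poly" where
    "q = pochhammer [:2, 1:] j * pochhammer [:real j + 4, 1:] (m - Suc j)"
  have "pochhammer (real k + 2) (Suc m) / ((real k + real j + 2) * (real k + real j + 3)) =
      poly q (real k)" for k
  proof -
    have m: "Suc m = j + (2 + (m - Suc j))" using assms by simp
    have "pochhammer (real k + 2) (Suc m) = pochhammer (real k + 2) j *
        ((real k + real j + 2) * (real k + real j + 3) * pochhammer (real k + real j + 4) (m - Suc j))"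
      unfolding m pochhammer_product' by (simp add: numeral_2_eq_2 pochhammer_Suc add_ac)
    then show ?thesis
      by (simp add: q_def poly_pochhammer add_ac)
  qed
  moreover have "(\<Sum>k\<le>m. (- 1) ^ k * real (m choose k) * poly q (real k)) = 0"
  proof (rule alternating_binomial_sum_poly)
    fix i assume "i \<ge> m"
    moreover have "degree q \<le> j + (m - Suc j)"
      unfolding q_def
      by (rule order.trans[OF degree_mult_le]) (simp add: degree_lead_coeff_pochhammer_linear)
    ultimately show "coeff q i = 0"
      using assms by (intro coeff_eq_0) simp
  qed
  ultimately show ?thesis
    unfolding bernoulli_umbra_hahn_poly_mult_pochhammer by simp
qed

text \<open>The pairing of \<open>hahn_poly m\<close> with any monic polynomial of degree
  \<open>m\<close>, not with itself.\<close>

definition hahn_norm :: "nat \<Rightarrow> real" where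
  "hahn_norm m = (fact (m + 1))\<^sup>2 * fact m * fact (m + 2) / fact (2 * m + 3)"

lemma hahn_norm_neq_0: "hahn_norm m \<noteq> 0"
  by (simp add: hahn_norm_def)

text \<open>For \<open>j = m\<close> the denominator k+m+2 still cancels but k+m+3 does not, so one
  simple pole contributes.\<close>

lemma bernoulli_umbra_hahn_poly_norm:
  "bernoulli_umbra (monom 1 2 * hahn_poly m * pochhammer [:1, - 1:] m) = (- 1) ^ m * hahn_norm m"
proof -
  let ?g = "pochhammer [:2, 1:] m :: real poly"
  have "pochhammer (real k + 2) (Suc m) / ((real k + real m + 2) * (real k + real m + 3)) =
      poly ?g (real k) / (real k + (real m + 3))" for k
    by (simp add: pochhammer_Suc poly_pochhammer add_ac divide_simps)
  \<comment> \<open>This product is (-m-1)(-m)...(-2).\<close>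
  moreover have "poly ?g (- (real m + 3)) = (- 1) ^ m * fact (m + 1)"
    using pochhammer_minus[of "real m + 1" m] pochhammer_rec[of "1 :: real" m]
    by (simp add: poly_pochhammer pochhammer_fact minus_diff_commute)
  moreover have "fact (m + 2) * pochhammer (real m + 3) (Suc m) = fact (2 * m + 3)"
    using pochhammer_product'[of "1 :: real" "m + 2" "Suc m"]
    by (simp add: pochhammer_fact mult_2 add_ac numeral_eq_Suc del: pochhammer_Suc)
  then have "fact m / pochhammer (real m + 3) (Suc m) = fact m * fact (m + 2) / fact (2 * m + 3)"
    by (metis fact_nonzero mult.commute mult_divide_mult_cancel_left)
  moreover have "degree ?g \<le> m" by (simp add: degree_lead_coeff_pochhammer_linear)
  then have "(\<Sum>k\<le>m. (- 1) ^ k * real (m choose k) * (poly ?g (real k) / (real k + (real m + 3)))) =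
      poly ?g (- (real m + 3)) * (fact m / pochhammer (real m + 3) (Suc m))"
    by (rule alternating_binomial_sum_poly_divide) simp
  ultimately have "bernoulli_umbra (monom 1 2 * hahn_poly m * pochhammer [:1, - 1:] m) =
      fact (Suc m) * ((- 1) ^ m * fact (m + 1) * (fact m * fact (m + 2) / fact (2 * m + 3)))"
    unfolding bernoulli_umbra_hahn_poly_mult_pochhammer by (simp only:)
  then show ?thesis
    by (simp add: hahn_norm_def power2_eq_square mult_ac del: fact_Suc)
qed

text \<open>Modulo lower degrees, which pair to 0, \<open>q\<close> is \<open>?c\<close> times
  \<open>?e m\<close>; the sign in \<open>?c\<close> accounts for the leading coefficient of
  \<open>?e m\<close>.\<close>

lemma bernoulli_umbra_hahn_poly_mult:
  assumes "degree q \<le> m"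
  shows "bernoulli_umbra (monom 1 2 * hahn_poly m * q) = coeff q m * hahn_norm m"
proof -
  let ?\<phi> = "\<lambda>q. bernoulli_umbra (monom 1 2 * hahn_poly m * q)"
  let ?e = "\<lambda>j. pochhammer [:1, - 1 :: real:] j"
  let ?c = "(- 1) ^ m * coeff q m"
  have add: "?\<phi> (p + q) = ?\<phi> p + ?\<phi> q" for p q
    by (simp only: distrib_left bernoulli_umbra_add)
  have smult: "?\<phi> (smult c p) = c * ?\<phi> p" for c p
    by (simp only: mult_smult_right bernoulli_umbra_smult)
  have e: "degree (?e j) = j" "coeff (?e j) j = (- 1) ^ j" for j
    using degree_lead_coeff_pochhammer_linear[of "- 1 :: real" 1 j] by auto
  have "?\<phi> (q + smult (- ?c) (?e m)) = 0"
  proof (rule linear_functional_eq_0[where \<phi> = ?\<phi> and e = ?e and m = m])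
    fix i assume "i \<ge> m"
    then show "coeff (q + smult (- ?c) (?e m)) i = 0"
      using assms by (cases "i = m") (auto simp: e coeff_eq_0)
  next
    fix j
    show "?e j \<noteq> 0" using e(2)[of j] by auto
  qed (use bernoulli_umbra_hahn_poly_orthogonal in \<open>simp_all only: add smult e\<close>)
  then show ?thesis
    by (simp only: add smult bernoulli_umbra_hahn_poly_norm) simp
qed

section \<open>The functional at the orthogonal polynomial and the harmonic number\<close>

lemma coeff_1_pochhammer:
  "coeff (pochhammer [:1, 1 :: real:] n) 1 = fact n * harm n"
proof (induction n)
  case (Suc n)
  have "coeff (pochhammer [:1, 1 :: real:] n) 0 = fact n"
    by (simp add: poly_pochhammer pochhammer_fact flip: poly_0_coeff_0)
  then show ?case
    using Suc by (simp add: pochhammer_Suc harm_Suc of_nat_poly field_simps)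
qed (simp add: harm_def)

text \<open>With y = k + 1 the summand is (a + y q(y)) / y^2. The double pole a / y^2 and the simple
  pole q(y) / y each contribute m! times the harmonic number, hence the factor 2.\<close>

lemma bernoulli_umbra_hahn_poly:
  "bernoulli_umbra (hahn_poly m) = 2 * fact m * harm (Suc m)"
proof -
  obtain a q where G: "pochhammer [:1, 1 :: real:] (Suc m) = pCons a q"
    by (cases "pochhammer [:1, 1 :: real:] (Suc m)")
  have a: "a = fact (Suc m)"
    using arg_cong[OF G, of "\<lambda>p. poly p 0"] by (simp add: poly_pochhammer pochhammer_fact)
  have q0: "poly q 0 = fact (Suc m) * harm (Suc m)"
    using coeff_1_pochhammer[of "Suc m"] by (simp add: G poly_0_coeff_0)
  have "degree (pCons a q) = Suc m"
    by (simp add: degree_lead_coeff_pochhammer_linear flip: G)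
  then have "degree q \<le> m" by (simp split: if_splits)
  then have deg: "degree (q \<circ>\<^sub>p [:1, 1:]) \<le> m" by (simp add: degree_pcompose)
  have "bernoulli_umbra (hahn_poly m) = (\<Sum>k\<le>m. (- 1) ^ k * real (m choose k) *
      (pochhammer (real k + 2) (Suc m) / (real k + 1)\<^sup>2))"
    unfolding hahn_poly_def bernoulli_umbra_sum
    by (intro sum.cong) (simp_all add: bernoulli_umbra_smult bernoulli_umbra_pochhammer_1
          power2_eq_square add_ac del: pochhammer_Suc)
  also have "\<dots> = (\<Sum>k\<le>m. (- 1) ^ k * real (m choose k) *
      (a * (1 / (real k + 1)\<^sup>2) + poly (q \<circ>\<^sub>p [:1, 1:]) (real k) / (real k + 1)))"
  proof (intro sum.cong refl)
    fix k
    have "pochhammer (real k + 2) (Suc m) = poly (pCons a q) (real k + 1)"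
      unfolding G[symmetric] poly_pochhammer by (simp add: add_ac)
    then show "(- 1) ^ k * real (m choose k) * (pochhammer (real k + 2) (Suc m) / (real k + 1)\<^sup>2) =
        (- 1) ^ k * real (m choose k) *
        (a * (1 / (real k + 1)\<^sup>2) + poly (q \<circ>\<^sub>p [:1, 1:]) (real k) / (real k + 1))"
      by (simp add: poly_pcompose power2_eq_square add_divide_distrib add_ac)
  qed
  also have "\<dots> = a * (\<Sum>k\<le>m. (- 1) ^ k * real (m choose k) * (1 / (real k + 1)\<^sup>2)) +
      (\<Sum>k\<le>m. (- 1) ^ k * real (m choose k) * (poly (q \<circ>\<^sub>p [:1, 1:]) (real k) / (real k + 1)))"
    unfolding sum_distrib_left sum.distrib[symmetric]
    by (intro sum.cong refl) (simp add: distrib_left)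
  also have "\<dots> = a * (fact m / fact (Suc m) * (\<Sum>i\<le>m. 1 / (1 + real i))) +
      poly q 0 * (fact m / fact (Suc m))"
    using alternating_binomial_sum_inverse_square[of 1 m]
      alternating_binomial_sum_poly_divide[OF deg, of 1]
    by (simp add: poly_pcompose pochhammer_fact del: fact_Suc)
  also have "(\<Sum>i\<le>m. 1 / (1 + real i)) = harm (Suc m)"
    unfolding harm_altdef by (simp add: divide_inverse lessThan_Suc_atMost)
  finally show ?thesis
    by (simp add: a q0 del: fact_Suc)
qed

section \<open>Parity of the orthogonal polynomials\<close>

text \<open>The weight x^2 keeps B_1 out, and all other Bernoulli numbers of odd index
  vanish.\<close>

lemma bernoulli_umbra_reflect:
  "bernoulli_umbra (monom 1 2 * (p \<circ>\<^sub>p [:0, - 1:])) = bernoulli_umbra (monom 1 2 * p)"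
proof -
  have deg: "degree (monom 1 2 * p) \<le> degree p + 2" for p :: "real poly"
    using degree_mult_le[of "monom 1 2" p] by (simp add: degree_monom_eq)
  have "coeff (monom 1 2 * (p \<circ>\<^sub>p [:0, - 1:])) i * bernoulli i = coeff (monom 1 2 * p) i * bernoulli i" for i
  proof (cases "i < 2")
    case False
    then show ?thesis
      using bernoulli_odd_eq_0[of i]
      by (cases "even i") (auto simp: coeff_monom_mult coeff_pcompose_linear)
  qed (simp add: coeff_monom_mult)
  moreover have "degree (p \<circ>\<^sub>p [:0, - 1:]) = degree p"
    by (simp add: degree_pcompose)
  ultimately show ?thesis
    using deg[of p] deg[of "p \<circ>\<^sub>p [:0, - 1:]"]
    by (simp only: bernoulli_umbra_altdef[of _ "degree p + 2"])
qed

text \<open>The odd part of an orthogonal polynomial of even degree is again orthogonal to all lower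
  degrees, but has lower degree itself.\<close>

lemma hahn_poly_even: "hahn_poly (2 * n) \<circ>\<^sub>p [:0, - 1:] = hahn_poly (2 * n)"
proof (rule ccontr)
  let ?P = "hahn_poly (2 * n)" and ?R = "[:0, - 1 :: real:]"
  define d where "d = ?P - ?P \<circ>\<^sub>p ?R"
  assume "?P \<circ>\<^sub>p ?R \<noteq> ?P"
  then have "d \<noteq> 0" by (simp add: d_def)
  define e where "e = degree d"
  have "e \<le> 2 * n"
    unfolding e_def d_def
    by (rule degree_diff_le) (simp_all add: degree_pcompose degree_hahn_poly_le)
  \<comment> \<open>In even degree the reflection fixes the leading coefficient.\<close>
  moreover have "coeff d (2 * n) = 0"
    by (simp add: d_def coeff_pcompose_linear)
  moreover have "coeff d e \<noteq> 0"
    using \<open>d \<noteq> 0\<close> by (simp add: e_def)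
  ultimately have "e < 2 * n"
    by (metis le_neq_implies_less)
  then have deg: "degree (hahn_poly e) < 2 * n"
    using degree_hahn_poly_le[of e] by simp
  have orth: "bernoulli_umbra (monom 1 2 * ?P * q) = 0" if "degree q < 2 * n" for q
    using that bernoulli_umbra_hahn_poly_mult[of q "2 * n"] by (simp add: coeff_eq_0)
  have "?R \<circ>\<^sub>p ?R = [:0, 1:]" by (simp add: pcompose_pCons)
  \<comment> \<open>Reflecting twice is the identity, which lets the reflection move from
    \<open>?P\<close> to \<open>hahn_poly e\<close>.\<close>
  then have "hahn_poly e \<circ>\<^sub>p ?R \<circ>\<^sub>p ?R = hahn_poly e"
    by (simp flip: pcompose_assoc)
  then have "bernoulli_umbra (monom 1 2 * (?P \<circ>\<^sub>p ?R) * hahn_poly e) =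
      bernoulli_umbra (monom 1 2 * ((?P * (hahn_poly e \<circ>\<^sub>p ?R)) \<circ>\<^sub>p ?R))"
    by (simp add: pcompose_mult mult.assoc)
  also have "\<dots> = 0"
    unfolding bernoulli_umbra_reflect
    using orth[of "hahn_poly e \<circ>\<^sub>p ?R"] deg by (simp add: degree_pcompose mult.assoc)
  finally have "bernoulli_umbra (monom 1 2 * d * hahn_poly e) = 0"
    using orth[OF deg] by (simp add: d_def left_diff_distrib right_diff_distrib bernoulli_umbra_diff)
  \<comment> \<open>The same pairing, now with \<open>hahn_poly e\<close> as the orthogonal
    polynomial and \<open>d\<close> of degree \<open>e\<close> as the test polynomial.\<close>
  moreover have "bernoulli_umbra (monom 1 2 * hahn_poly e * d) = coeff d e * hahn_norm e"
    by (rule bernoulli_umbra_hahn_poly_mult) (simp add: e_def)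
  ultimately show False
    using \<open>coeff d e \<noteq> 0\<close> hahn_norm_neq_0[of e] by (simp add: mult_ac)
qed

lemma coeff_hahn_poly_odd: "odd i \<Longrightarrow> coeff (hahn_poly (2 * n)) i = 0"
  using arg_cong[OF hahn_poly_even, of "\<lambda>p. coeff p i" n] by (simp add: coeff_pcompose_linear)

section \<open>Even-indexed moments and the determinant formula\<close>

lemma sum_even_indices:
  fixes f :: "nat \<Rightarrow> 'a :: comm_monoid_add"
  assumes "\<And>i. odd i \<Longrightarrow> f i = 0"
  shows "(\<Sum>i\<le>2 * n. f i) = (\<Sum>j\<le>n. f (2 * j))"
  by (induction n) (simp_all add: assms)

text \<open>By evenness only Bernoulli numbers with index congruent to \<open>l\<close> mod 2 enter:
  \<open>l = 0\<close> gives the first row of the unshifted Hankel matrix,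
  \<open>l = 2 * i + 2\<close> the orthogonality relations.\<close>

lemma bernoulli_umbra_monom_mult_hahn_poly:
  "bernoulli_umbra (monom 1 l * hahn_poly (2 * n)) =
    (\<Sum>j\<le>n. coeff (hahn_poly (2 * n)) (2 * j) * bernoulli (2 * j + l))"
proof -
  let ?P = "hahn_poly (2 * n)"
  have "degree (monom 1 l * ?P) \<le> l + 2 * n"
    by (rule order.trans[OF degree_mult_le])
       (simp add: degree_monom_eq degree_hahn_poly_le)
  then have "bernoulli_umbra (monom 1 l * ?P) =
      (\<Sum>i\<le>l + 2 * n. coeff (monom 1 l * ?P) i * bernoulli i)"
    by (rule bernoulli_umbra_altdef)
  also have "\<dots> = (\<Sum>i\<in>{l..l + 2 * n}. coeff (monom 1 l * ?P) i * bernoulli i)"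
    by (rule sum.mono_neutral_right) (auto simp: coeff_monom_mult)
  also have "\<dots> = (\<Sum>i\<le>2 * n. coeff ?P i * bernoulli (i + l))"
    by (rule sum.reindex_bij_witness[of _ "\<lambda>i. i + l" "\<lambda>i. i - l"]) (auto simp: coeff_monom_mult)
  also have "\<dots> = (\<Sum>j\<le>n. coeff ?P (2 * j) * bernoulli (2 * j + l))"
    by (rule sum_even_indices) (simp add: coeff_hahn_poly_odd)
  finally show ?thesis .
qed

theorem proposition6p1:
  fixes n :: nat
  shows "hankel_det n (\<lambda>k. bernoulli (2 * k)) =
    (- 1) ^ n * (fact (4 * n + 3) / ((real n + 1) * fact (2 * n + 1) ^ 3)) *
      harm (2 * n + 1) * hankel_det n (\<lambda>k. bernoulli (2 * k + 2))"
proof -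
  \<comment> \<open>As \<open>hahn_poly (2 * n)\<close> is even, it is a polynomial in x^2 of degree
    \<open>n\<close>; these are its coefficients.\<close>
  define q where "q j = coeff (hahn_poly (2 * n)) (2 * j)" for j
  have moment: "(\<Sum>j\<le>n. q j * bernoulli (2 * (i + j + 1))) = (if i = n then hahn_norm (2 * n) else 0)"
    if "i \<le> n" for i
  proof -
    have "(\<Sum>j\<le>n. q j * bernoulli (2 * (i + j + 1))) =
        bernoulli_umbra (monom 1 (2 + 2 * i) * hahn_poly (2 * n))"
      unfolding bernoulli_umbra_monom_mult_hahn_poly q_def by (simp add: algebra_simps)
    also have "monom (1 :: real) (2 + 2 * i) = monom 1 2 * monom 1 (2 * i)"
      by (simp add: mult_monom)
    also have "\<dots> * hahn_poly (2 * n) = monom 1 2 * hahn_poly (2 * n) * monom 1 (2 * i)"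
      by (simp only: mult_ac)
    also have "bernoulli_umbra \<dots> = (if i = n then hahn_norm (2 * n) else 0)"
      using that by (subst bernoulli_umbra_hahn_poly_mult) (auto simp: degree_monom_eq)
    finally show ?thesis .
  qed
  have "hankel_det n (\<lambda>k. bernoulli (2 * k)) * (\<Sum>j\<le>n. q j * bernoulli (2 * (n + j + 1))) =
      (- 1) ^ n * (\<Sum>j\<le>n. q j * bernoulli (2 * j)) * hankel_det n (\<lambda>k. bernoulli (2 * (k + 1)))"
  proof (rule hankel_det_shift_ratio)
    show "q n \<noteq> 0" by (simp add: q_def coeff_hahn_poly_degree_neq_0)
  qed (use moment in auto)
  moreover have "(\<Sum>j\<le>n. q j * bernoulli (2 * j)) = 2 * fact (2 * n) * harm (2 * n + 1)"
    using bernoulli_umbra_monom_mult_hahn_poly[of 0 n]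
    by (simp add: q_def bernoulli_umbra_hahn_poly flip: one_poly_eq_simps)
  ultimately have "hankel_det n (\<lambda>k. bernoulli (2 * k)) * hahn_norm (2 * n) =
      (- 1) ^ n * (2 * fact (2 * n) * harm (2 * n + 1)) * hankel_det n (\<lambda>k. bernoulli (2 * k + 2))"
    using moment[of n] by simp
  then have "hankel_det n (\<lambda>k. bernoulli (2 * k)) =
      (- 1) ^ n * (2 * fact (2 * n) / hahn_norm (2 * n)) * harm (2 * n + 1) *
        hankel_det n (\<lambda>k. bernoulli (2 * k + 2))"
    using hahn_norm_neq_0[of "2 * n"] by (simp add: field_simps)
  also have "2 * fact (2 * n) / hahn_norm (2 * n) =
      fact (4 * n + 3) / ((real n + 1) * fact (2 * n + 1) ^ 3)"
  proof -
    \<comment> \<open>This splitting produces the factor n+1 and the third power of (2n+1)!.\<close>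
    have f: "fact (2 * n + 2) = 2 * (real n + 1) * fact (2 * n + 1)"
      by (simp add: algebra_simps)
    have "fact (2 * n + 1) ^ 2 * fact (2 * n) * (2 * (real n + 1) * fact (2 * n + 1)) =
        2 * fact (2 * n) * ((real n + 1) * fact (2 * n + 1) ^ 3)"
      unfolding power2_eq_square power3_eq_cube by (simp only: mult_ac)
    then have "hahn_norm (2 * n) =
        2 * fact (2 * n) * ((real n + 1) * fact (2 * n + 1) ^ 3) / fact (4 * n + 3)"
      unfolding hahn_norm_def f by simp
    then show ?thesis
      by (simp del: fact_Suc)
  qed
  finally show ?thesis .
qed

end
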